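(* Every Frenet curve has a family of successor curves. More precisely, let $\mathcal F=(\mathbf T,\mathbf N,\mathbf B,\kappa,\tau)$ be a Frenet system on an interval $I\subset\mathbb R$ and let $s_0\in I$. The totality of successor systems $\mathcal F_1=(\mathbf T_1,\mathbf N_1,\mathbf B_1,\kappa_1,\tau_1)$ of $\mathcal F$ (i.e. Frenet systems with $\mathbf N_1\equiv\mathbf T$) is given by $$\begin{pmatrix}\mathbf T_1\\ \mathbf N_1\\ \mathbf B_1\end{pmatrix}=\begin{pmatrix}0&-\cos\varphi&\sin\varphi\\ 1&0&0\\ 0&\sin\varphi&\cos\varphi\end{pmatrix}\begin{pmatrix}\mathbf T\\ \mathbf N\\ \mathbf B\end{pmatrix},\qquad \begin{pmatrix}\kappa_1\\ \tau_1\end{pmatrix}=\kappa\begin{pmatrix}\cos\varphi\\ \sin\varphi\end{pmatrix},\qquad \varphi(s)=\varphi_0+\int_{s_0}^s\tau(\sigma)\,d\sigma,$$ where $\varphi_0\in\mathbb R$ is an arbitrary constant. For each such $\mathcal F_1$ the Darboux vector is $\mathbf D_{\omega 1}=\kappa\mathbf B$, and it is normalizable with angular speed $\kappa$ (the successor curve's signed Lancret curvature).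
   Context: All curves are unit speed (arc-length parametrized by $s$) $C^2$ curves $\mathbf x:I\to\mathbb R^3$, $I\subset\mathbb R$ an interval, with unit tangent $\mathbf T=\mathbf x'$. A principal normal of such a curve is a $C^1$ unit vector field $\mathbf N$ along it with $\mathbf N\perp\mathbf T$ and $\mathbf T'(s)$ a scalar multiple of $\mathbf N(s)$ for all $s$ (the scalar may be zero). A binormal is a $C^1$ unit vector field $\mathbf B$ with $\mathbf B\perp\mathbf T$ and $\mathbf B'\perp\mathbf T$. A Frenet frame is a positively oriented orthonormal frame $(\mathbf T,\mathbf N,\mathbf B)$ with $\mathbf T$ the tangent, $\mathbf N$ a principal normal and $\mathbf B$ a binormal. A Frenet curve is a curve having a Frenet frame. Given a Frenet frame, $\kappa=\langle\mathbf T',\mathbf N\rangle$ (signed curvature) and $\tau=\langle\mathbf N',\mathbf B\rangle$ (torsion) are continuous; the tuple $(\mathbf T,\mathbf N,\mathbf B,\kappa,\tau)$ is called a Frenet system (or Frenet apparatus), and its Darboux vector field is $\mathbf D_\omega=\tau\mathbf T+\kappa\mathbf B$. A vector field $\mathbf v$ is normalizable if it is everywhere linearly dependent on a unit vector field $\mathbf V$ of the same differentiation order (that is, $\mathbf v=\langle\mathbf v,\mathbf V\rangle\mathbf V$). When $\mathbf D_\omega$ is normalizable, $\mathbf D_\omega=\omega\mathbf D$ with $\mathbf D$ a continuous unit vector field (unit Darboux vector), and $\omega$ is the angular speed or signed Lancret curvature ($|\omega|=\sqrt{\kappa^2+\tau^2}$). A curve $\mathbf x_1=\mathbf x_1(s)$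 with the same arc length parameter is a successor curve of $\mathbf x$ if the tangent $\mathbf T$ of $\mathbf x$ is a principal normal of $\mathbf x_1$. A Frenet frame $(\mathbf T_1,\mathbf N_1,\mathbf B_1)$ is a successor frame of the Frenet frame $(\mathbf T,\mathbf N,\mathbf B)$ if $\mathbf N_1\equiv\mathbf T$; the corresponding Frenet system is called a successor system. *)

theory Defs
  imports "HOL-Analysis.Analysis"
begin

text \<open>
  Curves and vector fields along a curve are total functions on the reals of which only the values
  on the parameter interval \<open>I\<close> matter.  All derivatives are taken within \<open>I\<close>, hence are one-sided
  at endpoints belonging to \<open>I\<close>; they are uniquely determined when \<open>I\<close> is a non-degenerate interval.
\<close>

primrec Ck_on :: "nat \<Rightarrow> real set \<Rightarrow> (real \<Rightarrow> 'a::real_normed_vector) \<Rightarrow> bool" where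
  "Ck_on 0 I f \<longleftrightarrow> continuous_on I f"
| "Ck_on (Suc k) I f \<longleftrightarrow>
     (\<exists>f'. (\<forall>s\<in>I. (f has_vector_derivative f' s) (at s within I)) \<and> Ck_on k I f')"

abbreviation deriv_on :: "real set \<Rightarrow> (real \<Rightarrow> 'a::real_normed_vector) \<Rightarrow> real \<Rightarrow> 'a" where
  "deriv_on I f s \<equiv> vector_derivative f (at s within I)"

definition unit_speed_curve :: "real set \<Rightarrow> (real \<Rightarrow> real^3) \<Rightarrow> bool" where
  "unit_speed_curve I x \<longleftrightarrow> Ck_on 2 I x \<and> (\<forall>s\<in>I. norm (deriv_on I x s) = 1)"

definition tangent :: "real set \<Rightarrow> (real \<Rightarrow> real^3) \<Rightarrow> real \<Rightarrow> real^3" where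
  "tangent I x s = deriv_on I x s"

definition unit_field :: "nat \<Rightarrow> real set \<Rightarrow> (real \<Rightarrow> real^3) \<Rightarrow> bool" where
  "unit_field k I V \<longleftrightarrow> Ck_on k I V \<and> (\<forall>s\<in>I. norm (V s) = 1)"

definition principal_normal :: "real set \<Rightarrow> (real \<Rightarrow> real^3) \<Rightarrow> (real \<Rightarrow> real^3) \<Rightarrow> bool" where
  "principal_normal I x N \<longleftrightarrow> unit_field 1 I N \<and>
     (\<forall>s\<in>I. N s \<bullet> tangent I x s = 0 \<and> (\<exists>c. deriv_on I (tangent I x) s = c *\<^sub>R N s))"

definition binormal :: "real set \<Rightarrow> (real \<Rightarrow> real^3) \<Rightarrow> (real \<Rightarrow> real^3) \<Rightarrow> bool" where
  "binormal I x B \<longleftrightarrow> unit_field 1 I B \<and>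
     (\<forall>s\<in>I. B s \<bullet> tangent I x s = 0 \<and> deriv_on I B s \<bullet> tangent I x s = 0)"

text \<open>
  The remaining orthonormality relations of the frame are contained in \<^const>\<open>unit_speed_curve\<close>,
  \<^const>\<open>principal_normal\<close> and \<^const>\<open>binormal\<close>.
\<close>

definition frenet_frame ::
    "real set \<Rightarrow> (real \<Rightarrow> real^3) \<Rightarrow> (real \<Rightarrow> real^3) \<Rightarrow> (real \<Rightarrow> real^3) \<Rightarrow> (real \<Rightarrow> real^3) \<Rightarrow> bool" where
  "frenet_frame I x T N B \<longleftrightarrow> unit_speed_curve I x \<and> (\<forall>s\<in>I. T s = tangent I x s) \<and>
     principal_normal I x N \<and> binormal I x B \<and>
     (\<forall>s\<in>I. N s \<bullet> B s = 0 \<and> det (vector [T s, N s, B s] :: real^3^3) > 0)"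

definition frenet_curve :: "real set \<Rightarrow> (real \<Rightarrow> real^3) \<Rightarrow> bool" where
  "frenet_curve I x \<longleftrightarrow> (\<exists>T N B. frenet_frame I x T N B)"

definition frenet_system ::
    "real set \<Rightarrow> (real \<Rightarrow> real^3) \<Rightarrow> (real \<Rightarrow> real^3) \<Rightarrow> (real \<Rightarrow> real^3) \<Rightarrow>
     (real \<Rightarrow> real) \<Rightarrow> (real \<Rightarrow> real) \<Rightarrow> bool" where
  "frenet_system I T N B \<kappa> \<tau> \<longleftrightarrow> (\<exists>x. frenet_frame I x T N B) \<and>
     (\<forall>s\<in>I. \<kappa> s = deriv_on I T s \<bullet> N s \<and> \<tau> s = deriv_on I N s \<bullet> B s)"

definition successor_curve :: "real set \<Rightarrow> (real \<Rightarrow> real^3) \<Rightarrow> (real \<Rightarrow> real^3) \<Rightarrow> bool" where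
  "successor_curve I x x1 \<longleftrightarrow> unit_speed_curve I x1 \<and> principal_normal I x1 (tangent I x)"

text \<open>Of the given Frenet system only its tangent \<open>T\<close> enters the notion of a successor system.\<close>

definition successor_system ::
    "real set \<Rightarrow> (real \<Rightarrow> real^3) \<Rightarrow> (real \<Rightarrow> real^3) \<Rightarrow> (real \<Rightarrow> real^3) \<Rightarrow> (real \<Rightarrow> real^3) \<Rightarrow>
     (real \<Rightarrow> real) \<Rightarrow> (real \<Rightarrow> real) \<Rightarrow> bool" where
  "successor_system I T T1 N1 B1 \<kappa>1 \<tau>1 \<longleftrightarrow>
     frenet_system I T1 N1 B1 \<kappa>1 \<tau>1 \<and> (\<forall>s\<in>I. N1 s = T s)"

definition darboux ::
    "(real \<Rightarrow> real^3) \<Rightarrow> (real \<Rightarrow> real^3) \<Rightarrow> (real \<Rightarrow> real) \<Rightarrow> (real \<Rightarrow> real) \<Rightarrow> real \<Rightarrow> real^3" where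
  "darboux T B \<kappa> \<tau> s = \<tau> s *\<^sub>R T s + \<kappa> s *\<^sub>R B s"

text \<open>
  The argument \<open>k\<close> is the differentiation order at which the field is considered.  Darboux vector
  fields are fields of order \<open>0\<close>, since curvature and torsion are merely continuous.
\<close>

definition normalizable :: "nat \<Rightarrow> real set \<Rightarrow> (real \<Rightarrow> real^3) \<Rightarrow> bool" where
  "normalizable k I v \<longleftrightarrow> Ck_on k I v \<and>
     (\<exists>V. unit_field k I V \<and> (\<forall>s\<in>I. v s = (v s \<bullet> V s) *\<^sub>R V s))"

text \<open>
  The angular speed (signed Lancret curvature) depends on the choice of the unit Darboux vector
  \<open>D\<close>, so it is rendered as a relation.
\<close>

definition angular_speed ::
    "real set \<Rightarrow> (real \<Rightarrow> real^3) \<Rightarrow> (real \<Rightarrow> real^3) \<Rightarrow> (real \<Rightarrow> real) \<Rightarrow> (real \<Rightarrow> real) \<Rightarrow>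
     (real \<Rightarrow> real) \<Rightarrow> bool" where
  "angular_speed I T B \<kappa> \<tau> \<omega> \<longleftrightarrow>
     (\<exists>D. unit_field 0 I D \<and> (\<forall>s\<in>I. darboux T B \<kappa> \<tau> s = \<omega> s *\<^sub>R D s))"

end

theory Submission imports Defs begin

text \<open>
  On a non-degenerate interval, a Frenet system is the same thing as a positively oriented
  orthonormal frame that solves the Frenet equations \<open>T' = \<kappa> N\<close>, \<open>N' = - \<kappa> T + \<tau> B\<close>,
  \<open>B' = - \<tau> N\<close> with continuous coefficients
  (\<open>frenet_system_iff_frenet_equations\<close>): a curve having the frame is recovered by integrating
  \<open>T\<close>. Curves thereby disappear from the problem, and what remains is a statement about solutions
  of a linear differential equation.

  Existence: the normal plane of the given curve is spanned by \<open>N\<close> and \<open>B\<close>, and relative to this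
  basis the vectors of that plane that change only in the direction of \<open>T\<close> rotate at the rate
  \<open>\<tau>\<close>. Turning \<open>(- N, B)\<close> by an angle \<open>\<phi>\<close> with \<open>\<phi>' = \<tau>\<close> therefore gives two unit fields whose
  derivatives are multiples of \<open>T\<close>, that is, the tangent and binormal of a Frenet frame with
  principal normal \<open>T\<close> (\<open>rotating_frame_frenet_equations\<close>).

  Uniqueness: in two frames with the same principal normal, tangents and binormals have derivatives
  orthogonal to all of these vectors, so their mutual inner products are constant and the frames
  differ by a fixed rotation about the normal (\<open>common_normal_constant_angle\<close>). Comparing an
  arbitrary successor with the one of initial angle \<open>0\<close> exhibits the fixed angle as \<open>\<phi>0\<close>. No
  continuous angle function ever has to be extracted from a given successor.

  The Darboux vector \<open>\<tau>1 T1 + \<kappa>1 B1\<close> is \<open>\<kappa>\<close> times a combination of \<open>T1\<close> and \<open>B1\<close> in which the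
  rotation cancels and \<open>B\<close> is left.
\<close>

section \<open>Calculus on a non-degenerate interval\<close>

text \<open>
  Derivatives within the interval are unique because no point of it is isolated.
\<close>

lemma interval_point_not_isolated:
  fixes I :: "real set"
  assumes "is_interval I" "interior I \<noteq> {}" "s \<in> I"
  shows "at s within I \<noteq> bot"
proof -
  have "connected I" using assms(1) by (simp add: is_interval_connected)
  moreover have "I \<noteq> {s}" using assms(2) by auto
  ultimately have "s islimpt I"
    using connected_imp_perfect assms(3) by blast
  then show ?thesis by (simp add: trivial_limit_within)
qed

lemma deriv_on_eqI:
  assumes "is_interval I" "interior I \<noteq> {}" "s \<in> I"
    and "(f has_vector_derivative f') (at s within I)"
  shows "deriv_on I f s = f'"
  using vector_derivative_within[OF interval_point_not_isolated[OF assms(1-3)] assms(4)] .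

lemma deriv_on_cong:
  assumes "\<And>t. t \<in> I \<Longrightarrow> f t = g t" "s \<in> I"
  shows "deriv_on I f s = deriv_on I g s"
proof -
  have "(f has_vector_derivative d) (at s within I) \<longleftrightarrow> (g has_vector_derivative d) (at s within I)" for d
    using assms has_vector_derivative_transform[of s I f g] has_vector_derivative_transform[of s I g f]
    by auto
  then show ?thesis by (simp add: vector_derivative_def)
qed

lemma Ck_on_1I:
  assumes "\<And>s. s \<in> I \<Longrightarrow> (f has_vector_derivative f' s) (at s within I)" "continuous_on I f'"
  shows "Ck_on 1 I f"
  unfolding One_nat_def Ck_on.simps by (rule exI[of _ f']) (use assms in simp)

lemma Ck_on_1_cong:
  assumes "\<And>s. s \<in> I \<Longrightarrow> f s = g s" "Ck_on 1 I f"
  shows "Ck_on 1 I g"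
proof -
  obtain f' where f': "\<forall>s\<in>I. (f has_vector_derivative f' s) (at s within I)" "continuous_on I f'"
    using assms(2) by auto
  have "(g has_vector_derivative f' s) (at s within I)" if "s \<in> I" for s
    by (rule has_vector_derivative_transform[OF that _ f'(1)[rule_format, OF that]]) (simp add: assms(1))
  from this f'(2) show ?thesis by (rule Ck_on_1I)
qed

text \<open>
  The interval integral of a continuous integrand is known to be differentiable on compact
  intervals. Around each point, an arbitrary interval looks like a compact subinterval that
  also contains the base point.
\<close>

lemma interval_integral_has_vector_derivative:
  fixes f :: "real \<Rightarrow> 'a::euclidean_space"
  assumes "is_interval I" "continuous_on I f" "a \<in> I" "s \<in> I"
  shows "((\<lambda>u. LBINT y=a..u. f y) has_vector_derivative f s) (at s within I)"
proof -
  \<comment> \<open>If \<open>I\<close> contains no point beyond \<open>max a s\<close>, then \<open>r\<close> only has to exceed \<open>s\<close>; likewise on the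
    left.\<close>
  obtain q r where q: "q \<in> I" "a \<le> q" "s \<le> q" "s < r" "I \<inter> {..<r} \<subseteq> {..q}"
  proof (cases "\<exists>t\<in>I. max a s < t")
    case True
    then obtain t where "t \<in> I" "max a s < t" by auto
    then show ?thesis by (intro that[of t t]) auto
  next
    case False
    then show ?thesis using assms(3,4)
      by (intro that[of "max a s" "s + 1"]) (auto simp: max_def not_less split: if_splits)
  qed
  obtain p l where p: "p \<in> I" "p \<le> a" "p \<le> s" "l < s" "I \<inter> {l<..} \<subseteq> {p..}"
  proof (cases "\<exists>t\<in>I. t < min a s")
    case True
    then obtain t where "t \<in> I" "t < min a s" by auto
    then show ?thesis by (intro that[of t t]) auto
  next
    case False
    then show ?thesis using assms(3,4)
      by (intro that[of "min a s" "s - 1"]) (auto simp: min_def not_less split: if_splits)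
  qed
  have sub: "{p..q} \<subseteq> I"
  proof
    fix t assume "t \<in> {p..q}"
    then show "t \<in> I" using mem_is_interval_1_I[OF assms(1) p(1) q(1), of t] by simp
  qed
  have "((\<lambda>u. LBINT y=a..u. f y) has_vector_derivative f s) (at s within {p..q})"
    using p q continuous_on_subset[OF assms(2) sub] by (intro interval_integral_FTC2)
  moreover have "at s within I = at s within {p..q}"
  proof (rule at_within_nhd[of s "{l<..<r}"])
    have "I \<inter> {l<..<r} \<subseteq> {p..q}"
    proof
      fix t assume "t \<in> I \<inter> {l<..<r}"
      then have "t \<in> {..q}" "t \<in> {p..}" using p(5) q(5) by auto
      then show "t \<in> {p..q}" by simp
    qed
    with sub show "I \<inter> {l<..<r} - {s} = {p..q} \<inter> {l<..<r} - {s}" by blast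
  qed (use p(4) q(4) in auto)
  ultimately show ?thesis by simp
qed

lemma has_vector_derivative_inner:
  fixes f g :: "real \<Rightarrow> 'a::real_inner"
  assumes "(f has_vector_derivative f') (at s within I)" "(g has_vector_derivative g') (at s within I)"
  shows "((\<lambda>t. f t \<bullet> g t) has_vector_derivative (f s \<bullet> g' + f' \<bullet> g s)) (at s within I)"
  unfolding has_vector_derivative_def
  by (rule has_derivative_eq_rhs[OF has_derivative_inner[OF assms[unfolded has_vector_derivative_def]]])
    (simp add: fun_eq_iff distrib_left)

lemma inner_constant_derivative:
  fixes f g :: "real \<Rightarrow> 'a::real_inner"
  assumes I: "is_interval I" "interior I \<noteq> {}" "s \<in> I"
    and d: "(f has_vector_derivative f') (at s within I)" "(g has_vector_derivative g') (at s within I)"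
    and c: "\<And>t. t \<in> I \<Longrightarrow> f t \<bullet> g t = c"
  shows "f s \<bullet> g' + f' \<bullet> g s = 0"
proof -
  have "((\<lambda>t. c) has_vector_derivative (f s \<bullet> g' + f' \<bullet> g s)) (at s within I)"
    by (rule has_vector_derivative_transform[OF I(3) _ has_vector_derivative_inner[OF d]]) (simp add: c)
  then show ?thesis
    using deriv_on_eqI[OF I] deriv_on_eqI[OF I has_vector_derivative_const] by metis
qed

lemma constant_on_interval:
  fixes f :: "real \<Rightarrow> real"
  assumes "is_interval I" "\<And>s. s \<in> I \<Longrightarrow> (f has_vector_derivative 0) (at s within I)"
  obtains c where "\<And>s. s \<in> I \<Longrightarrow> f s = c"
proof -
  have "\<exists>c. \<forall>x\<in>I. f x = c"
    using assms
    by (intro has_derivative_zero_constant) (auto simp: has_vector_derivative_def is_interval_convex_1)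
  then show ?thesis using that by blast
qed

section \<open>Positively oriented orthonormal frames\<close>

text \<open>
  The third vector is given by the vector product, so that orthonormality and orientation of a new
  frame only require checking its first two vectors and one product.
\<close>

definition positive_frame :: "real^3 \<Rightarrow> real^3 \<Rightarrow> real^3 \<Rightarrow> bool" where
  "positive_frame u v w \<longleftrightarrow> norm u = 1 \<and> norm v = 1 \<and> u \<bullet> v = 0 \<and> w = cross3 u v"

lemma positive_frame_cross:
  assumes "positive_frame u v w"
  shows "cross3 u v = w" "cross3 v w = u" "cross3 w u = v"
    "cross3 v u = - w" "cross3 w v = - u" "cross3 u w = - v"
proof -
  have uv: "u \<bullet> u = 1" "v \<bullet> v = 1" "u \<bullet> v = 0" "v \<bullet> u = 0" and w: "w = cross3 u v"
    using assms by (auto simp: positive_frame_def norm_eq_1 inner_commute)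
  show 1: "cross3 u v = w" "cross3 v w = u" "cross3 w u = v"
    using uv cross_skew[of w u] by (simp_all add: w Lagrange)
  show "cross3 v u = - w" "cross3 w v = - u" "cross3 u w = - v"
    using 1 cross_skew[of v u] cross_skew[of w v] cross_skew[of u w] by simp_all
qed

lemma positive_frame_inner:
  assumes "positive_frame u v w"
  shows "u \<bullet> u = 1" "v \<bullet> v = 1" "w \<bullet> w = 1" "u \<bullet> v = 0" "v \<bullet> u = 0"
    "u \<bullet> w = 0" "w \<bullet> u = 0" "v \<bullet> w = 0" "w \<bullet> v = 0"
proof -
  show 1: "u \<bullet> u = 1" "v \<bullet> v = 1" "u \<bullet> v = 0" "v \<bullet> u = 0"
    using assms by (auto simp: positive_frame_def norm_eq_1 inner_commute)
  show "u \<bullet> w = 0" "w \<bullet> u = 0" "v \<bullet> w = 0" "w \<bullet> v = 0"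
    using assms by (auto simp: positive_frame_def dot_cross_self)
  show "w \<bullet> w = 1"
    using cross_triple[of u v w] positive_frame_cross[OF assms] 1 by simp
qed

text \<open>
  The difference of the two sides is orthogonal to \<open>u\<close> and \<open>v\<close>, so by the Lagrange identity it is
  also parallel to \<open>w\<close>; being orthogonal to \<open>w\<close> as well, it vanishes.
\<close>

lemma positive_frame_expansion:
  assumes "positive_frame u v w"
  shows "x = (x \<bullet> u) *\<^sub>R u + (x \<bullet> v) *\<^sub>R v + (x \<bullet> w) *\<^sub>R w"
proof -
  note ip = positive_frame_inner[OF assms]
  define z where "z = x - ((x \<bullet> u) *\<^sub>R u + (x \<bullet> v) *\<^sub>R v + (x \<bullet> w) *\<^sub>R w)"
  have z: "z \<bullet> u = 0" "z \<bullet> v = 0" "z \<bullet> w = 0"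
    by (simp_all add: z_def inner_diff_left inner_add_left ip)
  have "cross3 z w = 0"
    using Lagrange[of z u v] z positive_frame_cross(1)[OF assms] by simp
  then have "cross3 w z = cross3 w 0" using cross_skew[of w z] by simp
  moreover have "w \<bullet> z = w \<bullet> 0" using z by (simp add: inner_commute)
  moreover have "w \<noteq> 0" using ip(3) by auto
  ultimately have "z = 0" using cross_dot_cancel by blast
  then show ?thesis by (simp add: z_def)
qed

text \<open>
  Right to left: expanding \<open>w\<close> in the frame completed by \<open>c = u \<times> v\<close> shows that \<open>w\<close> is a multiple
  of \<open>c\<close>. The factor \<open>w \<bullet> c\<close> is the determinant, hence positive, and \<open>w\<close> and \<open>c\<close> are unit vectors.
\<close>

lemma positive_frame_iff_det:
  "positive_frame u v w \<longleftrightarrow>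
     norm u = 1 \<and> norm v = 1 \<and> norm w = 1 \<and> v \<bullet> u = 0 \<and> w \<bullet> u = 0 \<and> v \<bullet> w = 0 \<and>
     det (vector [u, v, w] :: real^3^3) > 0" (is "?L \<longleftrightarrow> ?R")
proof
  have det: "det (vector [u, v, w] :: real^3^3) = cross3 u v \<bullet> w"
    using cross_triple[of u v w] dot_cross_det[of u v w] by (simp add: inner_commute)
  {
    assume L: ?L
    then show ?R
      using positive_frame_inner[OF L] det by (simp add: norm_eq_1 positive_frame_cross(1)[OF L])
  next
    assume R: ?R
    define c where "c = cross3 u v"
    have f: "positive_frame u v c" using R by (simp add: positive_frame_def c_def inner_commute)
    have "w = (w \<bullet> c) *\<^sub>R c"
      using positive_frame_expansion[OF f, of w] R by (simp add: inner_commute)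
    moreover have "w \<bullet> c > 0" using R det by (simp add: c_def inner_commute)
    moreover have "norm c = 1" using positive_frame_inner(3)[OF f] by (simp add: norm_eq_1)
    ultimately have "w \<bullet> c = 1"
      using R by (metis abs_of_pos mult.right_neutral norm_scaleR)
    with \<open>w = (w \<bullet> c) *\<^sub>R c\<close> f show ?L by simp
  }
qed

lemma positive_frame_rotate:
  assumes f: "positive_frame u v w"
  shows "positive_frame (- cos a *\<^sub>R v + sin a *\<^sub>R w) u (sin a *\<^sub>R v + cos a *\<^sub>R w)"
  unfolding positive_frame_def
  by (simp add: norm_eq_1 inner_add_left inner_add_right positive_frame_inner[OF f]
      Cross3.left_diff_distrib cross_add_left cross_mult_left positive_frame_cross[OF f]
      power2_eq_square[symmetric] inner_diff_left inner_diff_right)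

text \<open>
  The matrix that turns \<open>(v, w)\<close> into the tangent and binormal of a successor is a reflection, hence
  its own inverse.
\<close>

lemma reflect_twice:
  fixes v w :: "'a::real_vector"
  shows "- cos a *\<^sub>R (- cos a *\<^sub>R v + sin a *\<^sub>R w) + sin a *\<^sub>R (sin a *\<^sub>R v + cos a *\<^sub>R w) = v"
    and "sin a *\<^sub>R (- cos a *\<^sub>R v + sin a *\<^sub>R w) + cos a *\<^sub>R (sin a *\<^sub>R v + cos a *\<^sub>R w) = w"
proof -
  have "- cos a *\<^sub>R (- cos a *\<^sub>R v + sin a *\<^sub>R w) + sin a *\<^sub>R (sin a *\<^sub>R v + cos a *\<^sub>R w)
      = ((sin a)\<^sup>2 + (cos a)\<^sup>2) *\<^sub>R v"
    by (simp add: power2_eq_square algebra_simps del: sin_cos_squared_add sin_cos_squared_add2 sin_cos_squared_add3)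
  then show "- cos a *\<^sub>R (- cos a *\<^sub>R v + sin a *\<^sub>R w) + sin a *\<^sub>R (sin a *\<^sub>R v + cos a *\<^sub>R w) = v"
    by simp
  have "sin a *\<^sub>R (- cos a *\<^sub>R v + sin a *\<^sub>R w) + cos a *\<^sub>R (sin a *\<^sub>R v + cos a *\<^sub>R w)
      = ((sin a)\<^sup>2 + (cos a)\<^sup>2) *\<^sub>R w"
    by (simp add: power2_eq_square algebra_simps del: sin_cos_squared_add sin_cos_squared_add2 sin_cos_squared_add3)
  then show "sin a *\<^sub>R (- cos a *\<^sub>R v + sin a *\<^sub>R w) + cos a *\<^sub>R (sin a *\<^sub>R v + cos a *\<^sub>R w) = w"
    by simp
qed

section \<open>Frenet systems as solutions of the Frenet equations\<close>

text \<open>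
  The continuity of the coefficients is what makes the frame continuously differentiable.
\<close>

definition frenet_equations ::
  "real set \<Rightarrow> (real \<Rightarrow> real^3) \<Rightarrow> (real \<Rightarrow> real^3) \<Rightarrow> (real \<Rightarrow> real^3) \<Rightarrow>
     (real \<Rightarrow> real) \<Rightarrow> (real \<Rightarrow> real) \<Rightarrow> bool" where
  "frenet_equations I T N B \<kappa> \<tau> \<longleftrightarrow> continuous_on I \<kappa> \<and> continuous_on I \<tau> \<and>
     (\<forall>s\<in>I. positive_frame (T s) (N s) (B s) \<and>
        (T has_vector_derivative \<kappa> s *\<^sub>R N s) (at s within I) \<and>
        (N has_vector_derivative - \<kappa> s *\<^sub>R T s + \<tau> s *\<^sub>R B s) (at s within I) \<and>
        (B has_vector_derivative - \<tau> s *\<^sub>R N s) (at s within I))"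

lemma frenet_equations_cong:
  assumes "\<And>s. s \<in> I \<Longrightarrow> T s = T' s" "\<And>s. s \<in> I \<Longrightarrow> N s = N' s" "\<And>s. s \<in> I \<Longrightarrow> B s = B' s"
    and "\<And>s. s \<in> I \<Longrightarrow> \<kappa> s = \<kappa>' s" "\<And>s. s \<in> I \<Longrightarrow> \<tau> s = \<tau>' s"
    and "frenet_equations I T N B \<kappa> \<tau>"
  shows "frenet_equations I T' N' B' \<kappa>' \<tau>'"
proof -
  note F = assms(6)[unfolded frenet_equations_def]
  have "continuous_on I \<kappa>'" "continuous_on I \<tau>'"
    using F continuous_on_eq[of I \<kappa> \<kappa>'] continuous_on_eq[of I \<tau> \<tau>'] assms(4,5) by blast+
  moreover have "(T' has_vector_derivative \<kappa>' s *\<^sub>R N' s) (at s within I)"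
    "(N' has_vector_derivative - \<kappa>' s *\<^sub>R T' s + \<tau>' s *\<^sub>R B' s) (at s within I)"
    "(B' has_vector_derivative - \<tau>' s *\<^sub>R N' s) (at s within I)"
    "positive_frame (T' s) (N' s) (B' s)" if s: "s \<in> I" for s
  proof -
    have "(T has_vector_derivative \<kappa> s *\<^sub>R N s) (at s within I)"
      "(N has_vector_derivative - \<kappa> s *\<^sub>R T s + \<tau> s *\<^sub>R B s) (at s within I)"
      "(B has_vector_derivative - \<tau> s *\<^sub>R N s) (at s within I)" "positive_frame (T s) (N s) (B s)"
      using F s by blast+
    note D = this[unfolded assms(1-5)[OF s]]
    show "(T' has_vector_derivative \<kappa>' s *\<^sub>R N' s) (at s within I)"
      by (rule has_vector_derivative_transform[OF s _ D(1)]) (simp add: assms(1))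
    show "(N' has_vector_derivative - \<kappa>' s *\<^sub>R T' s + \<tau>' s *\<^sub>R B' s) (at s within I)"
      by (rule has_vector_derivative_transform[OF s _ D(2)]) (simp add: assms(2))
    show "(B' has_vector_derivative - \<tau>' s *\<^sub>R N' s) (at s within I)"
      by (rule has_vector_derivative_transform[OF s _ D(3)]) (simp add: assms(3))
    show "positive_frame (T' s) (N' s) (B' s)" by (rule D(4))
  qed
  ultimately show ?thesis by (simp add: frenet_equations_def)
qed

lemma frenet_equations_curvatures:
  assumes I: "is_interval I" "interior I \<noteq> {}"
    and F: "frenet_equations I T N B \<kappa> \<tau>" and s: "s \<in> I"
  shows "deriv_on I T s \<bullet> N s = \<kappa> s" "deriv_on I N s \<bullet> B s = \<tau> s"
proof -
  have f: "positive_frame (T s) (N s) (B s)"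
    and d: "(T has_vector_derivative \<kappa> s *\<^sub>R N s) (at s within I)"
      "(N has_vector_derivative - \<kappa> s *\<^sub>R T s + \<tau> s *\<^sub>R B s) (at s within I)"
    using F s by (auto simp: frenet_equations_def)
  show "deriv_on I T s \<bullet> N s = \<kappa> s" "deriv_on I N s \<bullet> B s = \<tau> s"
    by (simp_all add: deriv_on_eqI[OF I s d(1)] deriv_on_eqI[OF I s d(2)]
        inner_add_left inner_diff_left
        positive_frame_inner[OF f])
qed

text \<open>
  Differentiating the orthonormality relations shows that the matrix of the derivatives in the frame
  is skew-symmetric. Its entries linking \<open>T\<close> and \<open>B\<close> vanish: \<open>T'\<close> is a multiple of \<open>N\<close> because \<open>N\<close> is
  a principal normal, and \<open>B'\<close> is orthogonal to \<open>T\<close> because \<open>B\<close> is a binormal.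
\<close>

lemma frenet_frame_imp_frenet_equations:
  assumes I: "is_interval I" "interior I \<noteq> {}" and F: "frenet_frame I x T N B"
  shows "frenet_equations I T N B (\<lambda>s. deriv_on I T s \<bullet> N s) (\<lambda>s. deriv_on I N s \<bullet> B s)"
proof -
  note defs = frenet_frame_def unit_speed_curve_def principal_normal_def binormal_def unit_field_def
  have Tt: "T s = tangent I x s" if "s \<in> I" for s using F that by (simp add: defs)
  have frame: "positive_frame (T s) (N s) (B s)" if "s \<in> I" for s
  proof -
    have "norm (deriv_on I x s) = 1" "norm (N s) = 1" "norm (B s) = 1" "N s \<bullet> tangent I x s = 0"
      "B s \<bullet> tangent I x s = 0" "N s \<bullet> B s = 0" "det (vector [T s, N s, B s] :: real^3^3) > 0"
      using F that unfolding defs by blast+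
    then show ?thesis
      unfolding positive_frame_iff_det using Tt[OF that] by (simp add: tangent_def)
  qed
  obtain x' x'' where x': "\<And>s. s \<in> I \<Longrightarrow> (x has_vector_derivative x' s) (at s within I)"
      "\<And>s. s \<in> I \<Longrightarrow> (x' has_vector_derivative x'' s) (at s within I)" "continuous_on I x''"
    using F unfolding defs numeral_2_eq_2 Ck_on.simps by blast
  obtain N' where N': "\<And>s. s \<in> I \<Longrightarrow> (N has_vector_derivative N' s) (at s within I)" "continuous_on I N'"
    using F unfolding defs One_nat_def Ck_on.simps by blast
  obtain B' where B': "\<And>s. s \<in> I \<Longrightarrow> (B has_vector_derivative B' s) (at s within I)"
    using F unfolding defs One_nat_def Ck_on.simps by blast
  have Tx': "T s = x' s" if "s \<in> I" for s
    using Tt[OF that] deriv_on_eqI[OF I that x'(1)[OF that]] by (simp add: tangent_def)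
  have T': "(T has_vector_derivative x'' s) (at s within I)" if "s \<in> I" for s
    using has_vector_derivative_transform[OF that Tx' x'(2)[OF that]] .
  have dT: "deriv_on I T s = x'' s" if "s \<in> I" for s using deriv_on_eqI[OF I that T'[OF that]] .
  have dN: "deriv_on I N s = N' s" if "s \<in> I" for s using deriv_on_eqI[OF I that N'(1)[OF that]] .
  have cont: "continuous_on I N" "continuous_on I B"
    using continuous_on_vector_derivative[OF N'(1)] continuous_on_vector_derivative[OF B'] by simp_all
  have "continuous_on I (\<lambda>s. deriv_on I T s \<bullet> N s)"
    using continuous_on_inner[OF x'(3) cont(1)] by (rule continuous_on_eq) (simp add: dT)
  moreover have "continuous_on I (\<lambda>s. deriv_on I N s \<bullet> B s)"
    using continuous_on_inner[OF N'(2) cont(2)] by (rule continuous_on_eq) (simp add: dN)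
  moreover
  {
    fix s assume s: "s \<in> I"
    note ip = positive_frame_inner[OF frame]
    note const = inner_constant_derivative[OF I s]
    have TN: "T s \<bullet> N' s + x'' s \<bullet> N s = 0" by (rule const[OF T'[OF s] N'(1)[OF s] ip(4)])
    have NN: "N s \<bullet> N' s + N' s \<bullet> N s = 0" by (rule const[OF N'(1)[OF s] N'(1)[OF s] ip(2)])
    have NB: "N s \<bullet> B' s + N' s \<bullet> B s = 0" by (rule const[OF N'(1)[OF s] B'[OF s] ip(8)])
    have BB: "B s \<bullet> B' s + B' s \<bullet> B s = 0" by (rule const[OF B'[OF s] B'[OF s] ip(3)])
    have BT: "B' s \<bullet> T s = 0"
      using F s deriv_on_eqI[OF I s B'[OF s]] Tt[OF s] by (auto simp: defs)
    have "deriv_on I (tangent I x) s = x'' s"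
      using deriv_on_cong[OF Tt s] dT[OF s] by simp
    then obtain c where c: "x'' s = c *\<^sub>R N s" using F s unfolding defs by metis
    have "x'' s = (x'' s \<bullet> N s) *\<^sub>R N s" using c ip[OF s] by simp
    moreover have "N' s = - (x'' s \<bullet> N s) *\<^sub>R T s + (N' s \<bullet> B s) *\<^sub>R B s"
    proof -
      have "N' s \<bullet> T s = - (x'' s \<bullet> N s)" "N' s \<bullet> N s = 0"
        using TN NN by (simp_all add: inner_commute)
      then show ?thesis using positive_frame_expansion[OF frame[OF s], of "N' s"] by simp
    qed
    moreover have "B' s = - (N' s \<bullet> B s) *\<^sub>R N s"
    proof -
      have "B' s \<bullet> N s = - (N' s \<bullet> B s)" "B' s \<bullet> B s = 0"
        using NB BB by (simp_all add: inner_commute)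
      then show ?thesis using positive_frame_expansion[OF frame[OF s], of "B' s"] BT by simp
    qed
    ultimately have "(T has_vector_derivative (x'' s \<bullet> N s) *\<^sub>R N s) (at s within I)"
      "(N has_vector_derivative - (x'' s \<bullet> N s) *\<^sub>R T s + (N' s \<bullet> B s) *\<^sub>R B s) (at s within I)"
      "(B has_vector_derivative - (N' s \<bullet> B s) *\<^sub>R N s) (at s within I)"
      using T'[OF s] N'(1)[OF s] B'[OF s] by simp_all
    note this frame[OF s]
  }
  ultimately show ?thesis by (simp add: frenet_equations_def dT dN)
qed

lemma frenet_equations_imp_frenet_frame:
  assumes I: "is_interval I" "interior I \<noteq> {}"
    and F: "frenet_equations I T N B \<kappa> \<tau>"
  obtains x where "frenet_frame I x T N B"
proof -
  obtain a where a: "a \<in> I" using I(2) interior_subset by blast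
  have frame: "positive_frame (T s) (N s) (B s)"
    and T': "(T has_vector_derivative \<kappa> s *\<^sub>R N s) (at s within I)"
    and N': "(N has_vector_derivative - \<kappa> s *\<^sub>R T s + \<tau> s *\<^sub>R B s) (at s within I)"
    and B': "(B has_vector_derivative - \<tau> s *\<^sub>R N s) (at s within I)" if "s \<in> I" for s
    using F that by (auto simp: frenet_equations_def)
  have cont: "continuous_on I T" "continuous_on I N" "continuous_on I B" "continuous_on I \<kappa>" "continuous_on I \<tau>"
    using continuous_on_vector_derivative[OF T'] continuous_on_vector_derivative[OF N']
      continuous_on_vector_derivative[OF B'] F by (simp_all add: frenet_equations_def)
  define x where "x = (\<lambda>u::real. LBINT y=a..u. T y)"
  have x': "(x has_vector_derivative T s) (at s within I)" if "s \<in> I" for s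
    unfolding x_def using interval_integral_has_vector_derivative[OF I(1) cont(1) a that] .
  have tan: "tangent I x s = T s" if "s \<in> I" for s
    using deriv_on_eqI[OF I that x'[OF that]] by (simp add: tangent_def)
  have dtan: "deriv_on I (tangent I x) s = \<kappa> s *\<^sub>R N s" if "s \<in> I" for s
    using deriv_on_cong[OF tan that] deriv_on_eqI[OF I that T'[OF that]] by simp
  have C1: "Ck_on 1 I T" "Ck_on 1 I N" "Ck_on 1 I B"
  proof -
    have "continuous_on I (\<lambda>s. \<kappa> s *\<^sub>R N s)" "continuous_on I (\<lambda>s. - \<kappa> s *\<^sub>R T s + \<tau> s *\<^sub>R B s)"
      "continuous_on I (\<lambda>s. - \<tau> s *\<^sub>R N s)"
      by (intro continuous_on_add continuous_on_scaleR continuous_on_minus cont)+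
    then show "Ck_on 1 I T" "Ck_on 1 I N" "Ck_on 1 I B"
      using Ck_on_1I[of I T, OF T'] Ck_on_1I[of I N, OF N'] Ck_on_1I[of I B, OF B'] by simp_all
  qed
  have "Ck_on 2 I x"
    unfolding numeral_2_eq_2 Ck_on.simps(2)[of "Suc 0"]
    by (rule exI[of _ T]) (use C1(1) x' in simp)
  then have "unit_speed_curve I x"
    using tan frame by (simp add: unit_speed_curve_def positive_frame_def flip: tangent_def)
  moreover have "principal_normal I x N"
  proof -
    have "\<exists>c. deriv_on I (tangent I x) s = c *\<^sub>R N s" if "s \<in> I" for s
      using dtan[OF that] by blast
    then show ?thesis
      using C1(2) tan frame
      by (auto simp: principal_normal_def unit_field_def positive_frame_def inner_commute)
  qed
  moreover have "binormal I x B"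
  proof -
    have "B s \<bullet> T s = 0" "deriv_on I B s \<bullet> T s = 0" "norm (B s) = 1" if "s \<in> I" for s
      using deriv_on_eqI[OF I that B'[OF that]] positive_frame_inner[OF frame[OF that]]
      by (simp_all add: norm_eq_1)
    then show ?thesis using C1(3) tan by (simp add: binormal_def unit_field_def)
  qed
  moreover have "N s \<bullet> B s = 0 \<and> det (vector [T s, N s, B s] :: real^3^3) > 0" if "s \<in> I" for s
    using frame[OF that] positive_frame_iff_det by blast
  ultimately have "frenet_frame I x T N B"
    using tan by (simp add: frenet_frame_def)
  then show ?thesis using that by blast
qed

lemma frenet_system_iff_frenet_equations:
  assumes I: "is_interval I" "interior I \<noteq> {}"
  shows "frenet_system I T N B \<kappa> \<tau> \<longleftrightarrow> frenet_equations I T N B \<kappa> \<tau>"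
proof
  assume F: "frenet_system I T N B \<kappa> \<tau>"
  then obtain x where "frenet_frame I x T N B" by (auto simp: frenet_system_def)
  from frenet_frame_imp_frenet_equations[OF I this] show "frenet_equations I T N B \<kappa> \<tau>"
    by (rule frenet_equations_cong[OF refl refl refl, rotated 2]) (use F in \<open>simp_all add: frenet_system_def\<close>)
next
  assume F: "frenet_equations I T N B \<kappa> \<tau>"
  obtain x where "frenet_frame I x T N B" by (rule frenet_equations_imp_frenet_frame[OF I F])
  moreover have "\<kappa> s = deriv_on I T s \<bullet> N s \<and> \<tau> s = deriv_on I N s \<bullet> B s" if "s \<in> I" for s
    by (simp only: frenet_equations_curvatures[OF I F that] simp_thms)
  ultimately show "frenet_system I T N B \<kappa> \<tau>" unfolding frenet_system_def by blast
qed

section \<open>Successor systems\<close>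

text \<open>
  The angle is any antiderivative of the torsion; its integration constant produces the whole family
  of successors.
\<close>

lemma rotating_frame_frenet_equations:
  assumes F: "frenet_equations I T N B \<kappa> \<tau>"
    and \<phi>: "\<And>s. s \<in> I \<Longrightarrow> (\<phi> has_vector_derivative \<tau> s) (at s within I)"
  shows "frenet_equations I (\<lambda>s. - cos (\<phi> s) *\<^sub>R N s + sin (\<phi> s) *\<^sub>R B s) T
    (\<lambda>s. sin (\<phi> s) *\<^sub>R N s + cos (\<phi> s) *\<^sub>R B s) (\<lambda>s. \<kappa> s * cos (\<phi> s)) (\<lambda>s. \<kappa> s * sin (\<phi> s))"
proof -
  have "continuous_on I \<phi>" by (rule continuous_on_vector_derivative) (rule \<phi>)
  moreover have "continuous_on I \<kappa>" using F by (simp add: frenet_equations_def)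
  ultimately have "continuous_on I (\<lambda>s. \<kappa> s * cos (\<phi> s))" "continuous_on I (\<lambda>s. \<kappa> s * sin (\<phi> s))"
    by (simp_all add: continuous_on_mult continuous_on_cos continuous_on_sin)
  moreover
  {
    fix s assume s: "s \<in> I"
    have f: "positive_frame (T s) (N s) (B s)"
      and T': "(T has_vector_derivative \<kappa> s *\<^sub>R N s) (at s within I)"
      and N': "(N has_vector_derivative - \<kappa> s *\<^sub>R T s + \<tau> s *\<^sub>R B s) (at s within I)"
      and B': "(B has_vector_derivative - \<tau> s *\<^sub>R N s) (at s within I)"
      using F s by (auto simp: frenet_equations_def)
    have \<phi>': "(\<phi> has_real_derivative \<tau> s) (at s within I)"
      using \<phi>[OF s] by (simp add: has_real_derivative_iff_has_vector_derivative)
    have co: "((\<lambda>s. cos (\<phi> s)) has_real_derivative - sin (\<phi> s) * \<tau> s) (at s within I)"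
      and si: "((\<lambda>s. sin (\<phi> s)) has_real_derivative cos (\<phi> s) * \<tau> s) (at s within I)"
      using \<phi>' by (auto intro!: derivative_eq_intros)
    \<comment> \<open>Rotating at the rate \<open>\<tau>\<close> cancels the torsion terms of \<open>N'\<close> and \<open>B'\<close>; only the
      \<open>T\<close>-component of \<open>N'\<close> survives.\<close>
    have "((\<lambda>s. - cos (\<phi> s) *\<^sub>R N s + sin (\<phi> s) *\<^sub>R B s) has_vector_derivative (\<kappa> s * cos (\<phi> s)) *\<^sub>R T s)
        (at s within I)"
      by (rule has_vector_derivative_eq_rhs[OF has_vector_derivative_add[OF
            has_vector_derivative_scaleR[OF DERIV_minus[OF co] N'] has_vector_derivative_scaleR[OF si B']]])
        (simp add: algebra_simps)
    moreover have "((\<lambda>s. sin (\<phi> s) *\<^sub>R N s + cos (\<phi> s) *\<^sub>R B s) has_vector_derivative - (\<kappa> s * sin (\<phi> s)) *\<^sub>R T s)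
        (at s within I)"
      by (rule has_vector_derivative_eq_rhs[OF has_vector_derivative_add[OF
            has_vector_derivative_scaleR[OF si N'] has_vector_derivative_scaleR[OF co B']]])
        (simp add: algebra_simps)
    moreover have "- (\<kappa> s * cos (\<phi> s)) *\<^sub>R (- cos (\<phi> s) *\<^sub>R N s + sin (\<phi> s) *\<^sub>R B s) +
        (\<kappa> s * sin (\<phi> s)) *\<^sub>R (sin (\<phi> s) *\<^sub>R N s + cos (\<phi> s) *\<^sub>R B s) = \<kappa> s *\<^sub>R N s"
      using arg_cong[OF reflect_twice(1), of "\<lambda>v. \<kappa> s *\<^sub>R v" "\<phi> s" "N s" "B s"]
      by (simp only: scaleR_add_right[of "\<kappa> s"] scaleR_scaleR mult_minus_right)
    ultimately have "positive_frame (- cos (\<phi> s) *\<^sub>R N s + sin (\<phi> s) *\<^sub>R B s) (T s)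
        (sin (\<phi> s) *\<^sub>R N s + cos (\<phi> s) *\<^sub>R B s)"
      "((\<lambda>s. - cos (\<phi> s) *\<^sub>R N s + sin (\<phi> s) *\<^sub>R B s) has_vector_derivative (\<kappa> s * cos (\<phi> s)) *\<^sub>R T s)
        (at s within I)"
      "(T has_vector_derivative - (\<kappa> s * cos (\<phi> s)) *\<^sub>R (- cos (\<phi> s) *\<^sub>R N s + sin (\<phi> s) *\<^sub>R B s) +
        (\<kappa> s * sin (\<phi> s)) *\<^sub>R (sin (\<phi> s) *\<^sub>R N s + cos (\<phi> s) *\<^sub>R B s)) (at s within I)"
      "((\<lambda>s. sin (\<phi> s) *\<^sub>R N s + cos (\<phi> s) *\<^sub>R B s) has_vector_derivative - (\<kappa> s * sin (\<phi> s)) *\<^sub>R T s)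
        (at s within I)"
      using positive_frame_rotate[OF f] T' by (simp_all only:)
    note this
  }
  ultimately show ?thesis unfolding frenet_equations_def by blast
qed

text \<open>
  Both tangents and both binormals move only in the direction of the common principal normal, to
  which all four are orthogonal; so the inner products between the two frames do not change.
\<close>

lemma common_normal_constant_angle:
  assumes I: "is_interval I" "interior I \<noteq> {}"
    and F: "frenet_equations I T M B \<kappa> \<tau>" and G: "frenet_equations I U M W \<kappa>' \<tau>'"
  obtains \<alpha> where "\<And>s. s \<in> I \<Longrightarrow> T s = cos \<alpha> *\<^sub>R U s + sin \<alpha> *\<^sub>R W s"
    "\<And>s. s \<in> I \<Longrightarrow> B s = - sin \<alpha> *\<^sub>R U s + cos \<alpha> *\<^sub>R W s"
proof -
  obtain a where a: "a \<in> I" using I(2) interior_subset by blast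
  have f: "positive_frame (T s) (M s) (B s)" and g: "positive_frame (U s) (M s) (W s)" if "s \<in> I" for s
    using F G that by (auto simp: frenet_equations_def)
  have T': "(T has_vector_derivative \<kappa> s *\<^sub>R M s) (at s within I)"
    and U': "(U has_vector_derivative \<kappa>' s *\<^sub>R M s) (at s within I)"
    and W': "(W has_vector_derivative - \<tau>' s *\<^sub>R M s) (at s within I)" if "s \<in> I" for s
    using F G that by (auto simp: frenet_equations_def)
  have "((\<lambda>s. T s \<bullet> U s) has_vector_derivative 0) (at s within I)" if "s \<in> I" for s
    using has_vector_derivative_inner[OF T' U', OF that that]
      positive_frame_inner[OF f[OF that]] positive_frame_inner[OF g[OF that]] by simp
  then obtain p where p: "\<And>s. s \<in> I \<Longrightarrow> T s \<bullet> U s = p"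
    using constant_on_interval[OF I(1), of "\<lambda>s. T s \<bullet> U s"] by blast
  have "((\<lambda>s. T s \<bullet> W s) has_vector_derivative 0) (at s within I)" if "s \<in> I" for s
    using has_vector_derivative_inner[OF T' W', OF that that]
      positive_frame_inner[OF f[OF that]] positive_frame_inner[OF g[OF that]] by simp
  then obtain q where q: "\<And>s. s \<in> I \<Longrightarrow> T s \<bullet> W s = q"
    using constant_on_interval[OF I(1), of "\<lambda>s. T s \<bullet> W s"] by blast
  have T: "T s = p *\<^sub>R U s + q *\<^sub>R W s" if "s \<in> I" for s
    using positive_frame_expansion[OF g[OF that], of "T s"] p[OF that] q[OF that]
      positive_frame_inner[OF f[OF that]] by simp
  have "p\<^sup>2 + q\<^sup>2 = 1"
  proof -
    have "1 = T a \<bullet> (p *\<^sub>R U a + q *\<^sub>R W a)"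
      using T[OF a] positive_frame_inner(1)[OF f[OF a]] by simp
    then show ?thesis using p[OF a] q[OF a] by (simp add: inner_add_right power2_eq_square)
  qed
  then obtain \<alpha> where \<alpha>: "p = cos \<alpha>" "q = sin \<alpha>" using sincos_total_2pi by metis
  have "B s = - sin \<alpha> *\<^sub>R U s + cos \<alpha> *\<^sub>R W s" if "s \<in> I" for s
  proof -
    have "B s = cross3 (T s) (M s)" using positive_frame_cross(1)[OF f[OF that]] by simp
    also have "\<dots> = - sin \<alpha> *\<^sub>R U s + cos \<alpha> *\<^sub>R W s"
      by (simp add: T[OF that] \<alpha> cross_add_left cross_mult_left positive_frame_cross[OF g[OF that]])
    finally show ?thesis .
  qed
  with T \<alpha> show ?thesis using that by blast
qed

text \<open>
  In the direction from left to right, the given successor is compared with the rotating frame of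
  integration constant \<open>0\<close>; the constant angle between the two is \<open>\<phi>0\<close> by the addition theorems.
\<close>

lemma successor_system_iff_rotating_frame:
  assumes I: "is_interval I" "interior I \<noteq> {}"
    and F: "frenet_system I T N B \<kappa> \<tau>"
    and \<psi>: "\<And>s. s \<in> I \<Longrightarrow> (\<psi> has_vector_derivative \<tau> s) (at s within I)"
  shows "successor_system I T T1 N1 B1 \<kappa>1 \<tau>1 \<longleftrightarrow>
    (\<exists>\<phi>0. \<forall>s\<in>I. T1 s = - cos (\<phi>0 + \<psi> s) *\<^sub>R N s + sin (\<phi>0 + \<psi> s) *\<^sub>R B s \<and> N1 s = T s \<and>
       B1 s = sin (\<phi>0 + \<psi> s) *\<^sub>R N s + cos (\<phi>0 + \<psi> s) *\<^sub>R B s \<and>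
       \<kappa>1 s = \<kappa> s * cos (\<phi>0 + \<psi> s) \<and> \<tau>1 s = \<kappa> s * sin (\<phi>0 + \<psi> s))" (is "?L \<longleftrightarrow> ?R")
proof
  have E: "frenet_equations I T N B \<kappa> \<tau>" using F frenet_system_iff_frenet_equations[OF I] by simp
  have rot: "frenet_equations I (\<lambda>s. - cos (c + \<psi> s) *\<^sub>R N s + sin (c + \<psi> s) *\<^sub>R B s) T
    (\<lambda>s. sin (c + \<psi> s) *\<^sub>R N s + cos (c + \<psi> s) *\<^sub>R B s)
    (\<lambda>s. \<kappa> s * cos (c + \<psi> s)) (\<lambda>s. \<kappa> s * sin (c + \<psi> s))" for c
    by (rule rotating_frame_frenet_equations[OF E])
      (use has_vector_derivative_add[OF has_vector_derivative_const \<psi>] in simp)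
  {
    assume ?R
    then obtain c where c: "\<And>s. s \<in> I \<Longrightarrow> T1 s = - cos (c + \<psi> s) *\<^sub>R N s + sin (c + \<psi> s) *\<^sub>R B s"
       "\<And>s. s \<in> I \<Longrightarrow> N1 s = T s"
       "\<And>s. s \<in> I \<Longrightarrow> B1 s = sin (c + \<psi> s) *\<^sub>R N s + cos (c + \<psi> s) *\<^sub>R B s"
       "\<And>s. s \<in> I \<Longrightarrow> \<kappa>1 s = \<kappa> s * cos (c + \<psi> s)" "\<And>s. s \<in> I \<Longrightarrow> \<tau>1 s = \<kappa> s * sin (c + \<psi> s)"
      by blast
    have "frenet_equations I T1 N1 B1 \<kappa>1 \<tau>1"
      by (rule frenet_equations_cong[OF _ _ _ _ _ rot[of c]]) (simp_all add: c)
    with c(2) show ?L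
      by (simp add: successor_system_def frenet_system_iff_frenet_equations[OF I])
  next
    assume L: ?L
    have N1: "N1 s = T s" if "s \<in> I" for s using L that by (simp add: successor_system_def)
    have E1: "frenet_equations I T1 N1 B1 \<kappa>1 \<tau>1"
      using L by (simp add: successor_system_def frenet_system_iff_frenet_equations[OF I])
    then have "frenet_equations I T1 T B1 \<kappa>1 \<tau>1"
      by (rule frenet_equations_cong[OF refl _ refl refl refl, rotated]) (rule N1)
    then obtain c where c: "\<And>s. s \<in> I \<Longrightarrow> T1 s = cos c *\<^sub>R (- cos (0 + \<psi> s) *\<^sub>R N s + sin (0 + \<psi> s) *\<^sub>R B s) +
         sin c *\<^sub>R (sin (0 + \<psi> s) *\<^sub>R N s + cos (0 + \<psi> s) *\<^sub>R B s)"
      "\<And>s. s \<in> I \<Longrightarrow> B1 s = - sin c *\<^sub>R (- cos (0 + \<psi> s) *\<^sub>R N s + sin (0 + \<psi> s) *\<^sub>R B s) +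
         cos c *\<^sub>R (sin (0 + \<psi> s) *\<^sub>R N s + cos (0 + \<psi> s) *\<^sub>R B s)"
      using common_normal_constant_angle[OF I _ rot[of 0]] by blast
    have T1: "T1 s = - cos (c + \<psi> s) *\<^sub>R N s + sin (c + \<psi> s) *\<^sub>R B s" if "s \<in> I" for s
      using c(1)[OF that] by (simp add: cos_add sin_add algebra_simps)
    have B1: "B1 s = sin (c + \<psi> s) *\<^sub>R N s + cos (c + \<psi> s) *\<^sub>R B s" if "s \<in> I" for s
      using c(2)[OF that] by (simp add: cos_add sin_add algebra_simps)
    \<comment> \<open>Curvature and torsion are functions of the frame, so they follow from the frame.\<close>
    have "frenet_equations I T1 N1 B1 (\<lambda>s. \<kappa> s * cos (c + \<psi> s)) (\<lambda>s. \<kappa> s * sin (c + \<psi> s))"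
      by (rule frenet_equations_cong[OF _ _ _ _ _ rot[of c]]) (simp_all add: T1 N1 B1)
    from frenet_equations_curvatures[OF I this] frenet_equations_curvatures[OF I E1]
    have "\<kappa>1 s = \<kappa> s * cos (c + \<psi> s)" "\<tau>1 s = \<kappa> s * sin (c + \<psi> s)" if "s \<in> I" for s
      using that by auto
    with T1 N1 B1 show ?R by (intro exI[of _ c]) blast
  }
qed

text \<open>
  The field \<open>T\<close> and the tangent of \<open>x\<close> agree on \<open>I\<close> only, so the property of being a principal normal
  has to be transported.
\<close>

lemma frenet_frame_tangent_normal_successor_curve:
  assumes x: "frenet_frame I x T N B" and x1: "frenet_frame I x1 T1 T B1"
  shows "successor_curve I x x1"
proof -
  have T: "T s = tangent I x s" if "s \<in> I" for s using x that by (simp add: frenet_frame_def)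
  have "principal_normal I x1 T" using x1 by (simp add: frenet_frame_def)
  then have "principal_normal I x1 (tangent I x)"
    using Ck_on_1_cong[OF T] T unfolding principal_normal_def unit_field_def by auto
  then show ?thesis using x1 by (simp add: successor_curve_def frenet_frame_def)
qed

lemma torsion_integral_has_vector_derivative:
  assumes I: "is_interval I" "interior I \<noteq> {}" "s0 \<in> I"
    and F: "frenet_system I T N B \<kappa> \<tau>" and s: "s \<in> I"
  shows "((\<lambda>u. LBINT \<sigma>=s0..u. \<tau> \<sigma>) has_vector_derivative \<tau> s) (at s within I)"
  using F frenet_system_iff_frenet_equations[OF I(1,2)] I s
  by (intro interval_integral_has_vector_derivative) (auto simp: frenet_equations_def)

lemma frenet_frame_successor_curve:
  assumes I: "is_interval I" "interior I \<noteq> {}"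
    and F: "frenet_system I T N B \<kappa> \<tau>" and x: "frenet_frame I x T N B"
    and \<phi>: "\<And>s. s \<in> I \<Longrightarrow> (\<phi> has_vector_derivative \<tau> s) (at s within I)"
  obtains x1 where "successor_curve I x x1"
    "\<And>s. s \<in> I \<Longrightarrow> tangent I x1 s = - cos (\<phi> s) *\<^sub>R N s + sin (\<phi> s) *\<^sub>R B s"
proof -
  have E: "frenet_equations I T N B \<kappa> \<tau>" using F frenet_system_iff_frenet_equations[OF I] by simp
  obtain x1 where x1: "frenet_frame I x1 (\<lambda>s. - cos (\<phi> s) *\<^sub>R N s + sin (\<phi> s) *\<^sub>R B s) T
      (\<lambda>s. sin (\<phi> s) *\<^sub>R N s + cos (\<phi> s) *\<^sub>R B s)"
    by (rule frenet_equations_imp_frenet_frame[OF I rotating_frame_frenet_equations[OF E \<phi>]])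
  have "successor_curve I x x1" using frenet_frame_tangent_normal_successor_curve[OF x x1] .
  moreover have "tangent I x1 s = - cos (\<phi> s) *\<^sub>R N s + sin (\<phi> s) *\<^sub>R B s" if "s \<in> I" for s
    using x1 that by (simp add: frenet_frame_def)
  ultimately show ?thesis using that by blast
qed

lemma rotated_frame_darboux:
  assumes "T1 s = - cos a *\<^sub>R N s + sin a *\<^sub>R B s" "B1 s = sin a *\<^sub>R N s + cos a *\<^sub>R B s"
    and "\<kappa>1 s = k * cos a" "\<tau>1 s = k * sin a"
  shows "darboux T1 B1 \<kappa>1 \<tau>1 s = k *\<^sub>R B s"
  using arg_cong[OF reflect_twice(2), of "\<lambda>v. k *\<^sub>R v" a "N s" "B s"]
  by (simp only: darboux_def assms scaleR_add_right[of k] scaleR_scaleR)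

lemma successor_system_darboux:
  assumes I: "is_interval I" "interior I \<noteq> {}"
    and F: "frenet_system I T N B \<kappa> \<tau>"
    and \<psi>: "\<And>s. s \<in> I \<Longrightarrow> (\<psi> has_vector_derivative \<tau> s) (at s within I)"
    and S: "successor_system I T T1 N1 B1 \<kappa>1 \<tau>1" and s: "s \<in> I"
  shows "darboux T1 B1 \<kappa>1 \<tau>1 s = \<kappa> s *\<^sub>R B s"
  using iffD1[OF successor_system_iff_rotating_frame[OF I F \<psi>] S] s
  by (blast intro: rotated_frame_darboux)

text \<open>
  The field \<open>B\<close> serves as the unit Darboux vector.
\<close>

lemma normalizable_angular_speedI:
  assumes B: "unit_field 0 I B" and k: "continuous_on I k"
    and D: "\<And>s. s \<in> I \<Longrightarrow> darboux T1 B1 \<kappa>1 \<tau>1 s = k s *\<^sub>R B s"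
  shows "normalizable 0 I (darboux T1 B1 \<kappa>1 \<tau>1)" "angular_speed I T1 B1 \<kappa>1 \<tau>1 k"
proof -
  have n: "B s \<bullet> B s = 1" if "s \<in> I" for s using B that by (simp add: unit_field_def norm_eq_1)
  have "continuous_on I (\<lambda>s. k s *\<^sub>R B s)"
    using B k by (simp add: unit_field_def continuous_on_scaleR)
  then have "continuous_on I (darboux T1 B1 \<kappa>1 \<tau>1)"
    by (rule continuous_on_eq) (simp add: D)
  then have "Ck_on 0 I (darboux T1 B1 \<kappa>1 \<tau>1)" by simp
  moreover have "\<forall>s\<in>I. darboux T1 B1 \<kappa>1 \<tau>1 s = (darboux T1 B1 \<kappa>1 \<tau>1 s \<bullet> B s) *\<^sub>R B s"
    by (simp add: D n)
  ultimately show "normalizable 0 I (darboux T1 B1 \<kappa>1 \<tau>1)"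
    using B unfolding normalizable_def by blast
  show "angular_speed I T1 B1 \<kappa>1 \<tau>1 k" using B D unfolding angular_speed_def by blast
qed

theorem theorem2p25:
  fixes I :: "real set" and s0 :: real
    and T N B :: "real \<Rightarrow> real^3" and \<kappa> \<tau> :: "real \<Rightarrow> real"
  assumes "is_interval I" and "interior I \<noteq> {}" and "s0 \<in> I"
    and "frenet_system I T N B \<kappa> \<tau>"
  shows
    "(\<forall>x. frenet_curve I x \<longrightarrow> (\<exists>x1. successor_curve I x x1)) \<and>
     (\<forall>x \<phi>0. frenet_frame I x T N B \<longrightarrow>
        (let \<phi> = (\<lambda>s::real. \<phi>0 + (LBINT \<sigma>=s0..s. \<tau> \<sigma>)) in
         \<exists>x1. successor_curve I x x1 \<and>
           (\<forall>s\<in>I. tangent I x1 s = - cos (\<phi> s) *\<^sub>R N s + sin (\<phi> s) *\<^sub>R B s))) \<and>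
     (\<forall>T1 N1 B1 \<kappa>1 \<tau>1. successor_system I T T1 N1 B1 \<kappa>1 \<tau>1 \<longleftrightarrow>
        (\<exists>\<phi>0. let \<phi> = (\<lambda>s::real. \<phi>0 + (LBINT \<sigma>=s0..s. \<tau> \<sigma>)) in
           \<forall>s\<in>I. T1 s = - cos (\<phi> s) *\<^sub>R N s + sin (\<phi> s) *\<^sub>R B s \<and>
                 N1 s = T s \<and>
                 B1 s = sin (\<phi> s) *\<^sub>R N s + cos (\<phi> s) *\<^sub>R B s \<and>
                 \<kappa>1 s = \<kappa> s * cos (\<phi> s) \<and>
                 \<tau>1 s = \<kappa> s * sin (\<phi> s))) \<and>
     (\<forall>T1 N1 B1 \<kappa>1 \<tau>1. successor_system I T T1 N1 B1 \<kappa>1 \<tau>1 \<longrightarrow>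
        (\<forall>s\<in>I. darboux T1 B1 \<kappa>1 \<tau>1 s = \<kappa> s *\<^sub>R B s) \<and>
        normalizable 0 I (darboux T1 B1 \<kappa>1 \<tau>1) \<and>
        angular_speed I T1 B1 \<kappa>1 \<tau>1 \<kappa>)"
proof (intro conjI allI impI)
  note I = assms(1-3) and F = assms(4)
  note char = successor_system_iff_rotating_frame[OF I(1,2) F torsion_integral_has_vector_derivative[OF I F]]
  {
    fix x assume "frenet_curve I x"
    then obtain T' N' B' where x: "frenet_frame I x T' N' B'" by (auto simp: frenet_curve_def)
    then have "frenet_system I T' N' B' (\<lambda>s. deriv_on I T' s \<bullet> N' s) (\<lambda>s. deriv_on I N' s \<bullet> B' s)"
      by (auto simp: frenet_system_def)
    from frenet_frame_successor_curve[OF I(1,2) this x torsion_integral_has_vector_derivative[OF I this]]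
    show "\<exists>x1. successor_curve I x x1" by metis
  next
    fix x \<phi>0 assume x: "frenet_frame I x T N B"
    have "((\<lambda>u. \<phi>0 + (LBINT \<sigma>=s0..u. \<tau> \<sigma>)) has_vector_derivative \<tau> s) (at s within I)" if "s \<in> I" for s
      using has_vector_derivative_add[OF has_vector_derivative_const
          torsion_integral_has_vector_derivative[OF I F that]] by simp
    from frenet_frame_successor_curve[OF I(1,2) F x this]
    show "let \<phi> = (\<lambda>s::real. \<phi>0 + (LBINT \<sigma>=s0..s. \<tau> \<sigma>)) in
         \<exists>x1. successor_curve I x x1 \<and>
           (\<forall>s\<in>I. tangent I x1 s = - cos (\<phi> s) *\<^sub>R N s + sin (\<phi> s) *\<^sub>R B s)"
      unfolding Let_def by metis
  next
    fix T1 N1 B1 \<kappa>1 \<tau>1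
    show "successor_system I T T1 N1 B1 \<kappa>1 \<tau>1 \<longleftrightarrow>
        (\<exists>\<phi>0. let \<phi> = (\<lambda>s::real. \<phi>0 + (LBINT \<sigma>=s0..s. \<tau> \<sigma>)) in
           \<forall>s\<in>I. T1 s = - cos (\<phi> s) *\<^sub>R N s + sin (\<phi> s) *\<^sub>R B s \<and>
                 N1 s = T s \<and>
                 B1 s = sin (\<phi> s) *\<^sub>R N s + cos (\<phi> s) *\<^sub>R B s \<and>
                 \<kappa>1 s = \<kappa> s * cos (\<phi> s) \<and>
                 \<tau>1 s = \<kappa> s * sin (\<phi> s))"
      unfolding Let_def by (rule char)
  next
    fix T1 N1 B1 \<kappa>1 \<tau>1 assume S: "successor_system I T T1 N1 B1 \<kappa>1 \<tau>1"
    have D: "darboux T1 B1 \<kappa>1 \<tau>1 s = \<kappa> s *\<^sub>R B s" if "s \<in> I" for s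
      by (rule successor_system_darboux[OF I(1,2) F torsion_integral_has_vector_derivative[OF I F] S that])
    have E: "frenet_equations I T N B \<kappa> \<tau>" using F frenet_system_iff_frenet_equations[OF I(1,2)] by simp
    have "unit_field 0 I B"
    proof -
      have "(B has_vector_derivative - \<tau> s *\<^sub>R N s) (at s within I)" if "s \<in> I" for s
        using E that by (simp add: frenet_equations_def)
      then have "continuous_on I B" by (rule continuous_on_vector_derivative)
      moreover have "norm (B s) = 1" if "s \<in> I" for s
        using E that by (auto simp: frenet_equations_def positive_frame_iff_det)
      ultimately show ?thesis by (simp add: unit_field_def)
    qed
    moreover have "continuous_on I \<kappa>" using E by (simp add: frenet_equations_def)
    ultimately have "normalizable 0 I (darboux T1 B1 \<kappa>1 \<tau>1)" "angular_speed I T1 B1 \<kappa>1 \<tau>1 \<kappa>"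
      using normalizable_angular_speedI D by blast+
    with D show "\<forall>s\<in>I. darboux T1 B1 \<kappa>1 \<tau>1 s = \<kappa> s *\<^sub>R B s"
      "normalizable 0 I (darboux T1 B1 \<kappa>1 \<tau>1)" "angular_speed I T1 B1 \<kappa>1 \<tau>1 \<kappa>" by blast+
  }
qed

end
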